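(* Let $G=(V,E)$ be a finite simple graph with $V=\{1,\dots,n\}$. Let $H,P$ be disjoint subsets of $V$ such that $G[H\cup P]$ is a generalized star with core $H$. Set $h=|H|$, $p=|P|$, and assume $G[P]$ is a $d$-regular graph. Then $b=p-d>1$, and for every real $c\notin[1,b]$, setting $$y_1=\frac{(c-1)p}{(c-1)p+(c-b)h},\qquad y_2=\frac{(c-b)h}{(c-1)p+(c-b)h},$$ the vector $\mathbf{x}=y_1\mathbf{x}^{P}+y_2\mathbf{x}^{H}$ is an element of $\mathrm{gKKT}(c)$ with support $H\cup P$.
   Context: Graphs are finite, undirected, unweighted, without loops. $A$ is the adjacency matrix of $G$, $I$ the $n\times n$ identity matrix, $\mathbf 1$ the all-ones vector. $\Delta_n=\{\mathbf{x}\in\mathbb{R}^n:\mathbf{1}^\top\mathbf{x}=1,\ \mathbf{x}\ge\mathbf 0\}$; the support of $\mathbf{x}$ is $\{i:x_i\ne0\}$. For non-empty $S\subseteq V$, the characteristic vector $\mathbf{x}^S\in\Delta_n$ has $x^S_i=|S|^{-1}$ if $i\in S$ and $0$ otherwise. $G[S]$ is the subgraph induced by $S$. A clique is a non-empty set of pairwise adjacent nodes; a graph is $d$-regular if every node has degree $d$. $\mathrm{gKKT}(c)$ is the set of generalized KKT points of $\max_{\mathbf{x}\in\Delta_n}\mathbf{x}^\top(A+cI)\mathbf{x}$: the set of $\mathbf{x}\in\Delta_n$ for which there exist $\mu_0\in\mathbb{R}$, $\boldsymbol\mu\in\mathbb{R}^n$ with $2(A+cI)\mathbf{x}+\mu_0\mathbf{1}+\boldsymbol\mu=\mathbf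 0$ and $\mu_ix_i=0$ for every $i\in V$ (no sign condition on $\boldsymbol\mu$). A graph $G'=(V',E')$ is a generalized star with core $H'$ if: (1) $H'$ is a proper non-empty subset of $V'$; (2) every node in $H'$ is adjacent to every node in $V'\setminus H'$; (3) $H'$ is a clique, but $V'$ is not a clique; (4) the induced subgraph $G'[V'\setminus H']$ is regular, but $V'\setminus H'$ is not a clique. *)

theory Defs
  imports "HOL-Analysis.Analysis" "Graph_Theory.Digraph_Component"
begin

text \<open>
  Finite simple undirected graphs are rendered by the locale predicate \<^const>\<open>graph\<close>: finite,
  loop-free digraphs without parallel arcs whose adjacency relation is symmetric. An undirected
  edge is thus a pair of opposite arcs, and the degree of a node is its \<^const>\<open>out_degree\<close>.
\<close>

definition regular_graph :: "nat \<Rightarrow> ('a, 'e) pre_digraph \<Rightarrow> bool" where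
  "regular_graph d G \<longleftrightarrow> (\<forall>v\<in>verts G. out_degree G v = d)"

definition is_clique :: "('a, 'e) pre_digraph \<Rightarrow> 'a set \<Rightarrow> bool" where
  "is_clique G S \<longleftrightarrow>
     S \<noteq> {} \<and> S \<subseteq> verts G \<and> (\<forall>u\<in>S. \<forall>v\<in>S. u \<noteq> v \<longrightarrow> u \<rightarrow>\<^bsub>G\<^esub> v)"

definition generalized_star :: "('a, 'e) pre_digraph \<Rightarrow> 'a set \<Rightarrow> bool" where
  "generalized_star G H \<longleftrightarrow>
     H \<noteq> {} \<and> H \<subset> verts G \<and>
     (\<forall>u\<in>H. \<forall>v\<in>verts G - H. u \<rightarrow>\<^bsub>G\<^esub> v) \<and>
     is_clique G H \<and> \<not> is_clique G (verts G) \<and>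
     (\<exists>d. regular_graph d (G \<restriction> (verts G - H))) \<and> \<not> is_clique G (verts G - H)"

text \<open>Below, the node set is the whole finite index type \<open>'n\<close>, so that \<open>n = CARD('n)\<close>.\<close>

definition adjacency_matrix :: "('n::finite, 'e) pre_digraph \<Rightarrow> real ^ 'n ^ 'n" where
  "adjacency_matrix G = (\<chi> i j. if i \<rightarrow>\<^bsub>G\<^esub> j then 1 else 0)"

text \<open>On \<^typ>\<open>real ^ 'n\<close>, the constant \<open>1\<close> is the all-ones vector, and \<open>mat 1\<close> is the
  identity matrix.\<close>

definition std_simplex :: "(real ^ 'n::finite) set" where
  "std_simplex = {x. 1 \<bullet> x = 1 \<and> (\<forall>i. 0 \<le> x $ i)}"

definition vec_support :: "real ^ 'n::finite \<Rightarrow> 'n set" where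
  "vec_support x = {i. x $ i \<noteq> 0}"

definition char_vec :: "'n::finite set \<Rightarrow> real ^ 'n" where
  "char_vec S = (\<chi> i. if i \<in> S then 1 / real (card S) else 0)"

definition gKKT :: "('n::finite, 'e) pre_digraph \<Rightarrow> real \<Rightarrow> (real ^ 'n) set" where
  "gKKT G c = {x \<in> std_simplex. \<exists>(\<mu>0 :: real) (\<mu> :: real ^ 'n).
     2 *\<^sub>R ((adjacency_matrix G + c *\<^sub>R mat 1) *v x) + \<mu>0 *\<^sub>R 1 + \<mu> = 0 \<and>
     (\<forall>i. \<mu> $ i * x $ i = 0)}"

end

theory Submission
  imports Defs
begin

text \<open>
  On \<open>H \<union> P\<close> the vector \<open>x\<close> takes the value \<open>u = (c - 1)/D\<close> on \<open>P\<close> and \<open>w = (c - b)/D\<close> on \<open>H\<close>,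
  where \<open>D = (c - 1)p + (c - b)h\<close>. For \<open>c\<close> outside \<open>[1, b]\<close> the factors \<open>c - 1\<close> and \<open>c - b\<close>
  are non-zero with equal sign, so both values are positive. The entries of \<open>(A + cI)x\<close> are
  \<open>(c + d)u + hw\<close> on \<open>P\<close> and \<open>pu + (c + h - 1)w\<close> on \<open>H\<close>; these agree because
  \<open>(c - b)u = (c - 1)w\<close>, and their common value determines \<open>\<mu>0\<close>.
\<close>

lemma arc_induce_subgraph_iff:
  "u \<rightarrow>\<^bsub>G \<restriction> S\<^esub> v \<longleftrightarrow> u \<in> S \<and> v \<in> S \<and> u \<rightarrow>\<^bsub>G\<^esub> v"
  by (auto simp: arcs_ends_def arc_to_ends_def induce_subgraph_def)

lemma is_clique_induce_subgraph_iff: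
  assumes "T \<subseteq> S"
  shows "is_clique (G \<restriction> S) T \<longleftrightarrow> T \<noteq> {} \<and> (\<forall>u\<in>T. \<forall>v\<in>T. u \<noteq> v \<longrightarrow> u \<rightarrow>\<^bsub>G\<^esub> v)"
  using assms unfolding is_clique_def arc_induce_subgraph_iff by auto

text \<open>Without parallel arcs an arc leaving \<open>v\<close> is determined by its head, so
  counting arcs amounts to counting neighbours.\<close>

lemma (in nomulti_digraph) out_degree_induce_subgraph:
  assumes "v \<in> S"
  shows "out_degree (G \<restriction> S) v = card {w \<in> S. v \<rightarrow>\<^bsub>G\<^esub> w}"
proof -
  have "bij_betw (head G) (out_arcs (G \<restriction> S) v) {w \<in> S. v \<rightarrow>\<^bsub>G\<^esub> w}"
    unfolding bij_betw_def
  proof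
    show "inj_on (head G) (out_arcs (G \<restriction> S) v)"
      using no_multi_arcs by (auto simp: inj_on_def out_arcs_def arc_to_ends_def)
    show "head G ` out_arcs (G \<restriction> S) v = {w \<in> S. v \<rightarrow>\<^bsub>G\<^esub> w}"
      using assms by (auto simp: out_arcs_def arcs_ends_def arc_to_ends_def)
  qed
  then show ?thesis
    by (simp add: out_degree_def bij_betw_same_card)
qed

lemma adjacency_matrix_mult_char_vec:
  "(adjacency_matrix G *v char_vec S) $ i = real (card {j \<in> S. i \<rightarrow>\<^bsub>G\<^esub> j}) / real (card S)"
proof -
  have "(adjacency_matrix G *v char_vec S) $ i
      = (\<Sum>j\<in>UNIV. if j \<in> {j \<in> S. i \<rightarrow>\<^bsub>G\<^esub> j} then 1 / real (card S) else 0)"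
    by (auto simp: matrix_vector_mult_def adjacency_matrix_def char_vec_def intro!: sum.cong)
  also have "\<dots> = (\<Sum>j\<in>{j \<in> S. i \<rightarrow>\<^bsub>G\<^esub> j}. 1 / real (card S))"
    by (subst sum.inter_restrict [symmetric]) auto
  finally show ?thesis by simp
qed

lemma one_inner_char_vec:
  assumes "S \<noteq> {}"
  shows "1 \<bullet> char_vec S = 1"
  using assms by (simp add: inner_vec_def char_vec_def sum.If_cases)

text \<open>Since \<open>\<mu>\<close> carries no sign condition, it can absorb the whole residual
  of the stationarity equation off the support. What remains is that \<open>(A + cI)x\<close> is
  constant on the support, and its value \<open>t\<close> gives \<open>\<mu>0 = -2t\<close>.\<close>

lemma gKKT_I:
  assumes "x \<in> std_simplex"
    and "\<And>i. x $ i \<noteq> 0 \<Longrightarrow> (adjacency_matrix G *v x) $ i + c * x $ i = t"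
  shows "x \<in> gKKT G c"
proof -
  define \<mu> :: "real ^ 'a" where
    "\<mu> = 2 *\<^sub>R (t *\<^sub>R 1 - (adjacency_matrix G + c *\<^sub>R mat 1) *v x)"
  have "((adjacency_matrix G + c *\<^sub>R mat 1) *v x) $ i = (adjacency_matrix G *v x) $ i + c * x $ i" for i
    by (simp add: matrix_vector_mult_add_rdistrib scaleR_matrix_vector_assoc [symmetric])
  then have "\<mu> $ i * x $ i = 0" for i
    using assms(2) [of i] by (auto simp: \<mu>_def)
  moreover have "2 *\<^sub>R ((adjacency_matrix G + c *\<^sub>R mat 1) *v x) + (- 2 * t) *\<^sub>R 1 + \<mu> = 0"
    by (simp add: \<mu>_def algebra_simps)
  ultimately show ?thesis
    using assms(1) unfolding gKKT_def by blast
qed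

theorem theorem5:
  fixes G :: "('n::finite, 'e) pre_digraph"
    and H P :: "'n set"
    and d :: nat
  assumes "graph G" and "verts G = UNIV"
    and "H \<inter> P = {}"
    and "generalized_star (G \<restriction> (H \<union> P)) H"
    and "regular_graph d (G \<restriction> P)"
  shows "let h = real (card H); p = real (card P); b = p - real d in
           b > 1 \<and>
           (\<forall>c::real. c \<notin> {1..b} \<longrightarrow>
              (let y1 = (c - 1) * p / ((c - 1) * p + (c - b) * h);
                   y2 = (c - b) * h / ((c - 1) * p + (c - b) * h);
                   x = y1 *\<^sub>R char_vec P + y2 *\<^sub>R char_vec H
               in x \<in> gKKT G c \<and> vec_support x = H \<union> P))"
proof -
  interpret graph G by fact
  note star = assms(4) [unfolded generalized_star_def]
  have diff: "H \<union> P - H = P"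
    using assms(3) by blast
  have H_ne: "H \<noteq> {}" and P_ne: "P \<noteq> {}"
    using star by auto
  have HP: "i \<rightarrow>\<^bsub>G\<^esub> j" if "i \<in> H" "j \<in> P" for i j
    using star that diff by (simp add: arc_induce_subgraph_iff)
  then have PH: "j \<rightarrow>\<^bsub>G\<^esub> i" if "i \<in> H" "j \<in> P" for i j
    using that by (blast intro: graph_symmetric)
  have HH: "i \<rightarrow>\<^bsub>G\<^esub> j" if "i \<in> H" "j \<in> H" "i \<noteq> j" for i j
    using star that by (simp add: is_clique_induce_subgraph_iff)
  have degP: "card {j \<in> P. i \<rightarrow>\<^bsub>G\<^esub> j} = d" if "i \<in> P" for i
    using assms(5) that by (simp add: regular_graph_def out_degree_induce_subgraph)
  define h p b where "h = real (card H)" and "p = real (card P)" and "b = p - real d"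
  have "h > 0" "p > 0"
    using H_ne P_ne by (auto simp: h_def p_def card_gt_0_iff)
  \<comment> \<open>Non-adjacent distinct nodes exist because \<open>P\<close> is not a clique. Node
    \<open>u\<close> then misses both itself (no loops) and \<open>v\<close> among its neighbours in
    \<open>P\<close>, whence \<open>d \<le> p - 2\<close>.\<close>
  obtain u v where uv: "u \<in> P" "v \<in> P" "u \<noteq> v" "\<not> u \<rightarrow>\<^bsub>G\<^esub> v"
    using star P_ne by (auto simp: diff is_clique_induce_subgraph_iff)
  have "d = card {j \<in> P. u \<rightarrow>\<^bsub>G\<^esub> j}"
    using degP uv by simp
  also have "\<dots> \<le> card (P - {u, v})"
    using uv by (intro card_mono) (auto dest: adj_not_same)
  also have "\<dots> = card P - 2"
    using uv by (simp add: card_Diff_subset)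
  finally have "d \<le> card P - 2" .
  \<comment> \<open>Subtraction on naturals truncates at 0; with two elements in \<open>P\<close> it
    is genuine, and \<open>b \<ge> 2\<close> follows over the reals.\<close>
  moreover have "card P \<ge> 2"
    using card_mono [of P "{u, v}"] uv by simp
  ultimately have b: "b > 1"
    by (simp add: b_def p_def)
  have "x \<in> gKKT G c \<and> vec_support x = H \<union> P"
    if c: "c \<notin> {1..b}"
      and x: "x = ((c - 1) * p / ((c - 1) * p + (c - b) * h)) *\<^sub>R char_vec P
        + ((c - b) * h / ((c - 1) * p + (c - b) * h)) *\<^sub>R char_vec H" for c x
  proof -
    define D where "D = (c - 1) * p + (c - b) * h"
    \<comment> \<open>\<open>y\<close> and \<open>z\<close> are the entries of \<open>x\<close> on
      \<open>P\<close> and \<open>H\<close>: the factors \<open>p\<close> and \<open>h\<close> in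
      the two weights cancel the normalisation of the characteristic vectors.\<close>
    define y where "y = (c - 1) / D"
    define z where "z = (c - b) / D"
    consider "c < 1" | "c > b" using c by fastforce
    then have pos: "y > 0 \<and> z > 0 \<and> D \<noteq> 0"
    proof cases
      case 1
      then have "(c - 1) * p < 0" "(c - b) * h < 0"
        using b \<open>h > 0\<close> \<open>p > 0\<close> by (auto simp: mult_neg_pos)
      then have "D < 0" by (simp add: D_def)
      with 1 b show ?thesis by (simp add: y_def z_def divide_neg_neg)
    next
      case 2
      then have "(c - 1) * p > 0" "(c - b) * h > 0"
        using b \<open>h > 0\<close> \<open>p > 0\<close> by auto
      then have "D > 0" by (simp add: D_def)
      with 2 b show ?thesis by (simp add: y_def z_def)
    qed
    have yz: "(c - b) * y = (c - 1) * z"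
      by (simp add: y_def z_def)
    have one: "p * y + h * z = 1"
      using pos by (simp add: y_def z_def D_def add_divide_distrib [symmetric] algebra_simps)
    have x': "x = (p * y) *\<^sub>R char_vec P + (h * z) *\<^sub>R char_vec H"
      by (simp add: x y_def z_def D_def mult.commute)
    have xi: "x $ i = (if i \<in> P then y else if i \<in> H then z else 0)" for i
      using assms(3) \<open>h > 0\<close> \<open>p > 0\<close> by (auto simp: x' char_vec_def p_def h_def)
    \<comment> \<open>Non-negativity is read off the entries, the unit sum off the combination of
      characteristic vectors.\<close>
    have simplex: "x \<in> std_simplex"
      using one pos
      by (simp add: std_simplex_def xi) (simp add: x' inner_add_right one_inner_char_vec H_ne P_ne)
    have Ax: "(adjacency_matrix G *v x) $ i
        = y * real (card {j \<in> P. i \<rightarrow>\<^bsub>G\<^esub> j}) + z * real (card {j \<in> H. i \<rightarrow>\<^bsub>G\<^esub> j})" for i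
      using \<open>h > 0\<close> \<open>p > 0\<close>
      by (simp add: x' matrix_vector_right_distrib matrix_vector_mult_scaleR
          adjacency_matrix_mult_char_vec p_def h_def)
    \<comment> \<open>The constant is the value on \<open>P\<close>, where a node has
      \<open>d\<close> neighbours in \<open>P\<close> and all of \<open>H\<close>.\<close>
    have "(adjacency_matrix G *v x) $ i + c * x $ i = (c + d) * y + h * z" if "x $ i \<noteq> 0" for i
    proof (cases "i \<in> P")
      case True
      then have "{j \<in> H. i \<rightarrow>\<^bsub>G\<^esub> j} = H" using PH by auto
      with True show ?thesis by (simp add: Ax xi degP h_def algebra_simps)
    next
      case False
      with that have i: "i \<in> H" by (auto simp: xi split: if_splits)
      have "{j \<in> P. i \<rightarrow>\<^bsub>G\<^esub> j} = P" using HP i by auto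
      \<comment> \<open>A node of the clique \<open>H\<close> is adjacent to all of \<open>H\<close>
        but itself, hence the \<open>h - 1\<close>.\<close>
      moreover have "{j \<in> H. i \<rightarrow>\<^bsub>G\<^esub> j} = H - {i}" using HH i by (auto dest: adj_not_same)
      moreover have "real (card (H - {i})) = h - 1"
        using i \<open>h > 0\<close> by (simp add: h_def card_Diff_singleton of_nat_diff)
      ultimately have "(adjacency_matrix G *v x) $ i + c * x $ i = y * p + z * (h - 1) + c * z"
        using False i by (simp add: Ax xi p_def)
      \<comment> \<open>With \<open>p = b + d\<close> the two sides differ by
        \<open>(c - 1) * z - (c - b) * y\<close>.\<close>
      then show ?thesis using yz by (simp add: b_def algebra_simps)
    qed
    with simplex have "x \<in> gKKT G c" by (rule gKKT_I)
    moreover have "vec_support x = H \<union> P"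
      using pos by (auto simp: vec_support_def xi)
    ultimately show ?thesis ..
  qed
  with b show ?thesis
    unfolding Let_def h_def p_def b_def by blast
qed

end
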